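(* Let $d$ be a fixed positive integer. Then there is no 0-1-symmetric language $L\subseteq\{0,1\}^*$ such that $\mathcal{G}_L$ equals the class of all $d$-degenerate graphs; more generally, no class $\mathcal{G}$ of graphs that is a hereditary subclass of the class of $d$-degenerate graphs, other than the class $\{N_n\mid n\geq 1\}$ of all edgeless graphs, equals $\mathcal{G}_L$ for any 0-1-symmetric language $L\subseteq\{0,1\}^*$.
   Context: All graphs are finite, simple, undirected, with nonempty vertex sets, and graph classes are considered up to isomorphism. A graph is $d$-degenerate if every subgraph has a vertex of degree at most $d$. A class is hereditary if it is closed under induced subgraphs. $N_n$ is the edgeless graph on $n$ vertices. For $w\in\{0,1\}^*$ let $\widetilde{w}$ be obtained from $w$ by exchanging the letters 0 and 1; a language $L\subseteq\{0,1\}^*$ is 0-1-symmetric if $L=\{\widetilde w : w\in L\}$. For an alphabet $V$ and distinct $u,v\in V$, $h_{u,v}:V^*\to\{0,1\}^*$ is the monoid morphism with $u\mapsto 0$, $v\mapsto 1$ and $x\mapsto\lambda$ (empty word) for all other letters $x$. For a 0-1-symmetric $L$ and a nonempty word $w$ whose set of occurring letters is $V$, $G(L,w)$ is the graph with vertex set $V$ in which distinct $u,v$ are adjacent iff $h_{u,v}(w)\in L$. A graph is $L$-representable if it is isomorphic to some $G(L,w)$, and $\mathcal{G}_L$ denotes the class of all $L$-representable graphs. *)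

theory Defs
  imports "Graph_Theory.Digraph_Isomorphism"
begin

(* Undirected graphs are symmetric loop-free digraphs: an edge uv is the pair of arcs
   (u,v), (v,u). Hence the degree of a vertex is its out_degree. *)

definition simple_graph :: "'a pair_pre_digraph \<Rightarrow> bool" where
  "simple_graph G \<longleftrightarrow> pair_graph G \<and> pverts G \<noteq> {}"

definition graph_iso :: "'a pair_pre_digraph \<Rightarrow> 'b pair_pre_digraph \<Rightarrow> bool" where
  "graph_iso G H \<longleftrightarrow> digraph_iso (with_proj G) (with_proj H)"

definition degenerate :: "nat \<Rightarrow> 'a pair_pre_digraph \<Rightarrow> bool" where
  "degenerate d G \<longleftrightarrow>
     (\<forall>H. simple_graph H \<and> subgraph (with_proj H) (with_proj G)
        \<longrightarrow> (\<exists>v\<in>pverts H. out_degree (with_proj H) v \<le> d))"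

(* Every finite graph is isomorphic to one whose vertices are natural numbers, so a class of
   graphs up to isomorphism is an isomorphism-closed set of graphs on subsets of nat. *)

definition graph_class :: "nat pair_pre_digraph set \<Rightarrow> bool" where
  "graph_class \<G> \<longleftrightarrow>
     (\<forall>G\<in>\<G>. simple_graph G) \<and>
     (\<forall>G\<in>\<G>. \<forall>H :: nat pair_pre_digraph. simple_graph H \<and> graph_iso G H \<longrightarrow> H \<in> \<G>)"

definition hereditary :: "nat pair_pre_digraph set \<Rightarrow> bool" where
  "hereditary \<G> \<longleftrightarrow>
     (\<forall>G\<in>\<G>. \<forall>H. simple_graph H \<and> induced_subgraph (with_proj H) (with_proj G) \<longrightarrow> H \<in> \<G>)"

definition degenerate_graphs :: "nat \<Rightarrow> nat pair_pre_digraph set" where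
  "degenerate_graphs d = {G. simple_graph G \<and> degenerate d G}"

definition edgeless_graph :: "nat \<Rightarrow> nat pair_pre_digraph" where
  "edgeless_graph n = \<lparr>pverts = {0..<n}, parcs = {}\<rparr>"

definition edgeless_graphs :: "nat pair_pre_digraph set" where
  "edgeless_graphs = {G. simple_graph G \<and> (\<exists>n\<ge>1. graph_iso G (edgeless_graph n))}"

(* Words over {0,1} are of type bool list, with 0 = False and 1 = True. *)

definition exchange :: "bool list \<Rightarrow> bool list" where
  "exchange w = map Not w"

definition zero_one_symmetric :: "bool list set \<Rightarrow> bool" where
  "zero_one_symmetric L \<longleftrightarrow> L = {exchange w | w. w \<in> L}"

definition pair_morphism :: "'a \<Rightarrow> 'a \<Rightarrow> 'a list \<Rightarrow> bool list" where
  "pair_morphism u v w = concat (map (\<lambda>x. if x = u then [False] else if x = v then [True] else []) w)"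

definition word_graph :: "bool list set \<Rightarrow> 'a list \<Rightarrow> 'a pair_pre_digraph" where
  "word_graph L w =
     \<lparr>pverts = set w, parcs = {(u, v). u \<in> set w \<and> v \<in> set w \<and> u \<noteq> v \<and> pair_morphism u v w \<in> L}\<rparr>"

lemma pair_morphism_swap: "u \<noteq> v \<Longrightarrow> pair_morphism v u w = exchange (pair_morphism u v w)"
  by (induction w) (auto simp: pair_morphism_def exchange_def)

lemma simple_graph_word_graph:
  assumes "zero_one_symmetric L" "w \<noteq> []"
  shows "simple_graph (word_graph L w)"
proof -
  have sym: "pair_morphism v u w \<in> L" if "u \<noteq> v" "pair_morphism u v w \<in> L" for u v
    using that assms(1) by (auto simp: pair_morphism_swap[OF that(1)] zero_one_symmetric_def)
  have "parcs (word_graph L w) \<subseteq> set w \<times> set w"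
    by (auto simp: word_graph_def)
  then have fin: "finite (parcs (word_graph L w))"
    by (rule finite_subset) simp
  have "pair_graph (word_graph L w)"
    by unfold_locales (use fin in \<open>auto simp: word_graph_def symmetric_def sym_def intro: sym\<close>)
  then show ?thesis
    using assms(2) by (simp add: simple_graph_def word_graph_def)
qed

(* Since only isomorphism to some G(L,w) matters, words over the alphabet nat suffice. *)

definition representable :: "bool list set \<Rightarrow> 'a pair_pre_digraph \<Rightarrow> bool" where
  "representable L G \<longleftrightarrow> (\<exists>w :: nat list. w \<noteq> [] \<and> graph_iso G (word_graph L w))"

definition representable_graphs :: "bool list set \<Rightarrow> nat pair_pre_digraph set" where
  "representable_graphs L = {G. simple_graph G \<and> representable L G}"

end

(* If some G(L, w) has an edge uv, put z = h_{u,v}(w), a word of L in which both letters occur.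
   Substituting a_1 ... a_n for 0 and b_1 ... b_n for 1 in z gives a word w' with
   h_{a_i,b_j}(w') = z for all i and j, so G(L, w') contains K_{n,n}, whose vertices all have
   degree n. For n = d + 1 it is not d-degenerate. Hence if every L-representable graph is
   d-degenerate, all of them are edgeless, and then every edgeless graph is represented by a word
   with the right number of letters. *)

theory Submission
  imports Defs
begin

section \<open>Morphisms to binary words and the blow-up of a word\<close>

lemma pair_morphism_Nil [simp]: "pair_morphism u v [] = []"
  by (simp add: pair_morphism_def)

lemma pair_morphism_append: "pair_morphism u v (xs @ ys) = pair_morphism u v xs @ pair_morphism u v ys"
  by (simp add: pair_morphism_def)

lemma set_pair_morphism:
  assumes "u \<in> set w" "v \<in> set w" "u \<noteq> v"
  shows "set (pair_morphism u v w) = UNIV"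
proof -
  have "False \<in> set (pair_morphism u v w)" "True \<in> set (pair_morphism u v w)"
    using assms by (auto simp: pair_morphism_def)
  then show ?thesis
    by (auto simp: UNIV_bool)
qed

text \<open>The letter \<open>i\<close> occurs once in the first block and not in the second,
  \<open>j\<close> once in the second and not in the first; all other letters are erased.\<close>

lemma pair_morphism_upt:
  fixes i j :: nat
  assumes "i < n" "n \<le> j" "j < 2 * n"
  shows "pair_morphism i j [0..<n] = [False]" "pair_morphism i j [n..<2 * n] = [True]"
proof -
  have "[0..<n] = [0..<i] @ i # [Suc i..<n]" "[n..<2 * n] = [n..<j] @ j # [Suc j..<2 * n]"
    using assms upt_add_eq_append[of 0 i "n - i"] upt_add_eq_append[of n j "2 * n - j"]
    by (auto simp: upt_conv_Cons)
  moreover have "pair_morphism i j (i # xs) = False # pair_morphism i j xs"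
    "pair_morphism i j (j # xs) = True # pair_morphism i j xs" for xs
    using assms by (simp_all add: pair_morphism_def)
  moreover have "pair_morphism i j [0..<i] = []" "pair_morphism i j [Suc i..<n] = []"
    "pair_morphism i j [n..<j] = []" "pair_morphism i j [Suc j..<2 * n] = []"
    using assms by (auto simp: pair_morphism_def)
  ultimately show "pair_morphism i j [0..<n] = [False]" "pair_morphism i j [n..<2 * n] = [True]"
    by (simp_all add: pair_morphism_append)
qed

text \<open>The letters substituted for 0 are the numbers below \<open>n\<close>, those for 1 the
  numbers from \<open>n\<close> to \<open>2 * n - 1\<close>.\<close>

definition blow_up :: "nat \<Rightarrow> bool list \<Rightarrow> nat list" where
  "blow_up n z = concat (map (\<lambda>b. if b then [n..<2 * n] else [0..<n]) z)"

lemma pair_morphism_blow_up: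
  assumes "i < n" "n \<le> j" "j < 2 * n"
  shows "pair_morphism i j (blow_up n z) = z"
  by (induction z) (simp_all add: blow_up_def pair_morphism_append pair_morphism_upt[OF assms])

text \<open>Both letters must occur in \<open>z\<close>: a block whose letter is missing would
  contribute no vertices.\<close>

lemma set_blow_up:
  assumes "set z = UNIV"
  shows "set (blow_up n z) = {0..<2 * n}"
proof -
  have "set (blow_up n z) = (\<Union>b\<in>set z. if b then {n..<2 * n} else {0..<n})"
    by (auto simp: blow_up_def)
  also have "\<dots> = {0..<2 * n}"
    unfolding assms by (auto simp: UNIV_bool)
  finally show ?thesis .
qed

section \<open>Complete bipartite graphs\<close>

lemma out_degree_with_proj:
  "out_degree (with_proj G) v = card {e \<in> parcs G. fst e = v}"
  by (simp add: out_degree_def out_arcs_def)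

text \<open>The sides are the two blocks of \<open>blow_up n\<close>, so that this graph sits in the
  word graph literally, without renaming vertices.\<close>

definition complete_bipartite_graph :: "nat \<Rightarrow> nat pair_pre_digraph" where
  "complete_bipartite_graph n =
     \<lparr>pverts = {0..<2 * n}, parcs = {0..<n} \<times> {n..<2 * n} \<union> {n..<2 * n} \<times> {0..<n}\<rparr>"

lemma simple_graph_complete_bipartite_graph:
  assumes "n \<ge> 1"
  shows "simple_graph (complete_bipartite_graph n)"
proof -
  have "pair_graph (complete_bipartite_graph n)"
    by unfold_locales (auto simp: complete_bipartite_graph_def symmetric_def sym_def)
  then show ?thesis
    using assms by (simp add: simple_graph_def complete_bipartite_graph_def)
qed

lemma out_degree_complete_bipartite_graph:
  assumes "v \<in> pverts (complete_bipartite_graph n)"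
  shows "out_degree (with_proj (complete_bipartite_graph n)) v = n"
proof -
  have "{e \<in> parcs (complete_bipartite_graph n). fst e = v} =
      {v} \<times> (if v < n then {n..<2 * n} else {0..<n})"
    using assms by (auto simp: complete_bipartite_graph_def)
  then show ?thesis
    by (simp add: out_degree_with_proj card_cartesian_product)
qed

lemma subgraph_with_projI:
  assumes "simple_graph H" "simple_graph G" "pverts H \<subseteq> pverts G" "parcs H \<subseteq> parcs G"
  shows "subgraph (with_proj H) (with_proj G)"
proof -
  interpret H: pair_graph H using assms(1) by (simp add: simple_graph_def)
  interpret G: pair_graph G using assms(2) by (simp add: simple_graph_def)
  show ?thesis
    using assms(3,4) by (auto simp: subgraph_def compatible_def H.wf_digraph_axioms G.wf_digraph_axioms)
qed

section \<open>Isomorphisms and edgeless graphs\<close>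

lemma graph_isoI:
  assumes "simple_graph G" "inj_on f (pverts G)"
    and "pverts H = f ` pverts G" "parcs H = map_prod f f ` parcs G"
  shows "graph_iso G H"
proof -
  interpret pair_graph G using assms(1) by (simp add: simple_graph_def)
  \<comment> \<open>Arcs are pairs of vertices, so the vertex map determines the arc map, and head
    and tail remain the projections.\<close>
  let ?h = "\<lparr>iso_verts = f, iso_arcs = map_prod f f, iso_head = snd, iso_tail = fst\<rparr>"
  have "parcs G \<subseteq> pverts G \<times> pverts G"
    using in_arcsD1 in_arcsD2 by auto
  then have "inj_on (map_prod f f) (parcs G)"
    by (rule inj_on_subset[OF map_prod_inj_on[OF assms(2) assms(2)]])
  then have "digraph_isomorphism ?h"
    using assms(2) by (simp add: digraph_isomorphism_def wf_digraph_axioms)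
  moreover have "with_proj H = app_iso ?h (with_proj G)"
    using assms(3,4) by (simp add: with_proj_def app_iso_def)
  ultimately show ?thesis
    unfolding graph_iso_def digraph_iso_def by blast
qed

lemma graph_iso_refl:
  assumes "simple_graph G"
  shows "graph_iso G G"
  using assms by (rule graph_isoI[where f = id]) (simp_all add: prod.map_id0)

lemma word_graph_representable:
  assumes "zero_one_symmetric L" "w \<noteq> []"
  shows "word_graph L w \<in> representable_graphs L"
  using assms simple_graph_word_graph[OF assms] graph_iso_refl
  by (auto simp: representable_graphs_def representable_def)

lemma graph_iso_parcs_empty_iff:
  assumes "graph_iso G H"
  shows "parcs G = {} \<longleftrightarrow> parcs H = {}"
proof -
  obtain h where "with_proj H = app_iso h (with_proj G)"
    using assms unfolding graph_iso_def digraph_iso_def by blast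
  then have "arcs (with_proj H) = iso_arcs h ` arcs (with_proj G)"
    by simp
  then show ?thesis
    by simp
qed

lemma graph_iso_edgeless_graph:
  assumes "simple_graph G" "parcs G = {}"
  shows "graph_iso G (edgeless_graph (card (pverts G)))"
proof -
  interpret pair_graph G using assms(1) by (simp add: simple_graph_def)
  obtain f where "bij_betw f (pverts G) {0..<card (pverts G)}"
    using ex_bij_betw_finite_nat[OF finite_verts] by auto
  then show ?thesis
    using assms by (intro graph_isoI[where f = f]) (auto simp: edgeless_graph_def bij_betw_def)
qed

text \<open>This trades the isomorphism to some N_n for a condition on arcs, which
  \<open>graph_iso_parcs_empty_iff\<close> carries over from word graphs.\<close>

lemma edgeless_graphs_iff: "G \<in> edgeless_graphs \<longleftrightarrow> simple_graph G \<and> parcs G = {}"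
proof
  assume "G \<in> edgeless_graphs"
  then show "simple_graph G \<and> parcs G = {}"
    using graph_iso_parcs_empty_iff by (fastforce simp: edgeless_graphs_def edgeless_graph_def)
next
  assume G: "simple_graph G \<and> parcs G = {}"
  then interpret pair_graph G by (simp add: simple_graph_def)
  have "card (pverts G) \<ge> 1"
    using G by (simp add: simple_graph_def Suc_le_eq card_gt_0_iff)
  then show "G \<in> edgeless_graphs"
    using G graph_iso_edgeless_graph by (auto simp: edgeless_graphs_def)
qed

section \<open>Representable classes of bounded degeneracy\<close>

lemma not_degenerate_blow_up:
  assumes "zero_one_symmetric L" "z \<in> L" "set z = UNIV"
  shows "\<not> degenerate d (word_graph L (blow_up (Suc d) z))"
proof
  let ?n = "Suc d" and ?w = "blow_up (Suc d) z"
  let ?K = "complete_bipartite_graph ?n"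
  assume deg: "degenerate d (word_graph L ?w)"
  have "?w \<noteq> []"
    using set_blow_up[OF assms(3), of ?n] by auto
  \<comment> \<open>The arc from \<open>j\<close> to \<open>i\<close> reads the exchanged word,
    which 0-1-symmetry puts into \<open>L\<close> as well.\<close>
  have exch: "exchange z \<in> L"
    using assms(1,2) by (auto simp: zero_one_symmetric_def)
  have "pair_morphism i j ?w \<in> L" "pair_morphism j i ?w \<in> L"
    if "i < ?n" "?n \<le> j" "j < 2 * ?n" for i j
    using pair_morphism_blow_up[OF that] pair_morphism_swap[of i j] that assms(2) exch by auto
  then have "parcs ?K \<subseteq> parcs (word_graph L ?w)"
    by (auto simp: complete_bipartite_graph_def word_graph_def set_blow_up[OF assms(3)])
  moreover have "pverts ?K \<subseteq> pverts (word_graph L ?w)"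
    by (auto simp: complete_bipartite_graph_def word_graph_def set_blow_up[OF assms(3)])
  \<comment> \<open>The subgraph need not be induced: \<open>L\<close> may also join letters of the
    same side. Degeneracy bounds all subgraphs, so this does no harm.\<close>
  ultimately have "subgraph (with_proj ?K) (with_proj (word_graph L ?w))"
    using simple_graph_word_graph[OF assms(1) \<open>?w \<noteq> []\<close>]
    by (intro subgraph_with_projI simple_graph_complete_bipartite_graph) auto
  then obtain v where "v \<in> pverts ?K" "out_degree (with_proj ?K) v \<le> d"
    using deg simple_graph_complete_bipartite_graph[of ?n] by (auto simp: degenerate_def)
  then show False
    by (simp add: out_degree_complete_bipartite_graph)
qed

lemma representable_graphs_degenerate_imp_edgeless:
  assumes "zero_one_symmetric L" "representable_graphs L \<subseteq> degenerate_graphs d"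
  shows "representable_graphs L = edgeless_graphs"
proof -
  have no_arcs: "parcs (word_graph L w) = {}" for w :: "nat list"
  proof (rule ccontr)
    assume "parcs (word_graph L w) \<noteq> {}"
    then obtain u v where uv: "u \<in> set w" "v \<in> set w" "u \<noteq> v" and z: "pair_morphism u v w \<in> L"
      by (auto simp: word_graph_def)
    let ?w = "blow_up (Suc d) (pair_morphism u v w)"
    have "?w \<noteq> []"
      using set_blow_up[OF set_pair_morphism[OF uv], of "Suc d"] by auto
    then have "degenerate d (word_graph L ?w)"
      using word_graph_representable assms by (auto simp: degenerate_graphs_def)
    then show False
      using not_degenerate_blow_up[OF assms(1) z set_pair_morphism[OF uv]] by blast
  qed
  have "G \<in> representable_graphs L" if "G \<in> edgeless_graphs" for G
  proof -
    from that obtain n where n: "n \<ge> 1" "graph_iso G (edgeless_graph n)" "simple_graph G"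
      by (auto simp: edgeless_graphs_def)
    \<comment> \<open>As no word yields arcs, only the set of letters matters; listing each vertex
      once gives the right one.\<close>
    have "edgeless_graph n = word_graph L [0..<n]"
      using no_arcs[of "[0..<n]"] by (simp add: edgeless_graph_def word_graph_def)
    with n have "[0..<n] \<noteq> [] \<and> graph_iso G (word_graph L [0..<n])"
      by simp
    with n(3) show ?thesis
      unfolding representable_graphs_def representable_def by blast
  qed
  moreover have "G \<in> edgeless_graphs" if "G \<in> representable_graphs L" for G
    using that no_arcs
    by (auto simp: representable_graphs_def representable_def edgeless_graphs_iff
        dest: graph_iso_parcs_empty_iff)
  ultimately show ?thesis by blast
qed

text \<open>K_{1,1} is a single edge, and degrees can only drop in subgraphs. It witnesses that for
  d \<ge> 1 the d-degenerate graphs are not all edgeless.\<close>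

lemma complete_bipartite_graph_1_degenerate:
  assumes "d \<ge> 1"
  shows "complete_bipartite_graph 1 \<in> degenerate_graphs d"
proof -
  let ?K = "complete_bipartite_graph 1"
  have "\<exists>v\<in>pverts H. out_degree (with_proj H) v \<le> d"
    if H: "simple_graph H" "subgraph (with_proj H) (with_proj ?K)" for H :: "nat pair_pre_digraph"
  proof -
    from H(1) obtain v where v: "v \<in> pverts H"
      by (auto simp: simple_graph_def)
    have sub: "parcs H \<subseteq> parcs ?K" "pverts H \<subseteq> pverts ?K"
      using H(2) by (auto simp: subgraph_def)
    have "out_degree (with_proj H) v \<le> out_degree (with_proj ?K) v"
      unfolding out_degree_with_proj
      using sub by (intro card_mono) (auto simp: complete_bipartite_graph_def)
    also have "\<dots> = 1"
      using sub v by (intro out_degree_complete_bipartite_graph) auto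
    finally show ?thesis
      using v assms by (meson le_trans)
  qed
  then show ?thesis
    using simple_graph_complete_bipartite_graph[of 1]
    by (auto simp: degenerate_graphs_def degenerate_def)
qed

theorem mainTheorem6:
  fixes d :: nat
  assumes "d \<ge> 1"
  shows "(\<nexists>L. zero_one_symmetric L \<and> representable_graphs L = degenerate_graphs d) \<and>
    (\<forall>\<G>. graph_class \<G> \<and> hereditary \<G> \<and> \<G> \<subseteq> degenerate_graphs d \<and> \<G> \<noteq> edgeless_graphs
      \<longrightarrow> (\<nexists>L. zero_one_symmetric L \<and> \<G> = representable_graphs L))"
proof -
  have "parcs (complete_bipartite_graph 1) \<noteq> {}"
    by (auto simp: complete_bipartite_graph_def)
  then have "degenerate_graphs d \<noteq> edgeless_graphs"
    using complete_bipartite_graph_1_degenerate[OF assms] edgeless_graphs_iff by blast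
  \<comment> \<open>A represented class of d-degenerate graphs must be
    \<open>edgeless_graphs\<close>. The class of all d-degenerate graphs differs from it by the edge
    above, the class in the second claim by assumption.\<close>
  then show ?thesis
    using representable_graphs_degenerate_imp_edgeless by blast
qed

end
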